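(* Let $(X,\sigma)$ be a biquandle and let $U_{nc}=U_{nc}(X,\sigma)$ be its universal biquandle 2-cocycle group. Denote by $[x,y]$ the class of $(x,y)$ in $U_{nc}$. (1) The map $\pi:X\times X\to U_{nc}$, $(x,y)\mapsto[x,y]$, is a type I non-commutative 2-cocycle. (2) If $H$ is a group and $f:X\times X\to H$ is a type I non-commutative 2-cocycle, then there exists a unique group homomorphism $\overline f:U_{nc}\to H$ such that $f=\overline f\circ\pi$.
   Context: A set-theoretical solution of the Yang-Baxter equation is a pair $(X,\sigma)$ with $\sigma:X\times X\to X\times X$ a bijection satisfying $(\mathrm{Id}\times\sigma)(\sigma\times\mathrm{Id})(\mathrm{Id}\times\sigma)=(\sigma\times\mathrm{Id})(\mathrm{Id}\times\sigma)(\sigma\times\mathrm{Id})$. Write $\sigma(x,y)=(\sigma^1(x,y),\sigma^2(x,y))$. It is a birack if moreover for all $x,z\in X$ there is a unique $y$ with $\sigma^1(x,y)=z$, and for all $y,t\in X$ there is a unique $x$ with $\sigma^2(x,y)=t$. A birack is a biquandle if there is a bijection $s:X\to X$ such that $\{(x,y):\sigma(x,y)=(x,y)\}=\{(x,s(x)):x\in X\}$. A function $f:X\times X\to H$ to a group $H$ is a non-commutative 2-cocycle if for all $x,y,z\in X$: $f(x,y)f(\sigma^2(x,y),z)=f(x,\sigma^1(y,z))\,f(\sigma^2(x,\sigma^1(y,z)),\sigma^2(y,z))$ and $f(\sigma^1(x,y),\sigma^1(\sigma^2(x,y),z))=f(y,z)$. It is of type I if $f(x,s(x))=1$ for all $x\in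 X$. $U_{nc}(X,\sigma)$ is the group generated by symbols $(x,y)\in X\times X$ with relations, for all $x,y,z\in X$: $(x,y)(\sigma^2(x,y),z)=(x,\sigma^1(y,z))(\sigma^2(x,\sigma^1(y,z)),\sigma^2(y,z))$; $(\sigma^1(x,y),\sigma^1(\sigma^2(x,y),z))=(y,z)$; $(x,s(x))=1$. *)

theory Defs
  imports "HOL-Algebra.Group"
begin

subsection \<open>Groups given by generators and relations\<close>

text \<open>The letter (g, True) stands for the generator g and (g, False) for its formal inverse.\<close>

type_synonym 'g word = "('g \<times> bool) list"

definition words :: "'g set \<Rightarrow> 'g word set" where
  "words S = lists (S \<times> UNIV)"

definition gen :: "'g \<Rightarrow> 'g word" where
  "gen g = [(g, True)]"

inductive_set word_cong :: "'g set \<Rightarrow> ('g word \<times> 'g word) set \<Rightarrow> ('g word \<times> 'g word) set"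
  for S :: "'g set" and R :: "('g word \<times> 'g word) set" where
  refl: "w \<in> words S \<Longrightarrow> (w, w) \<in> word_cong S R"
| sym: "(u, v) \<in> word_cong S R \<Longrightarrow> (v, u) \<in> word_cong S R"
| trans: "(u, v) \<in> word_cong S R \<Longrightarrow> (v, w) \<in> word_cong S R \<Longrightarrow> (u, w) \<in> word_cong S R"
| append: "(u, u') \<in> word_cong S R \<Longrightarrow> (v, v') \<in> word_cong S R \<Longrightarrow> (u @ v, u' @ v') \<in> word_cong S R"
| cancel: "g \<in> S \<Longrightarrow> ([(g, b), (g, \<not> b)], []) \<in> word_cong S R"
| relation: "(u, v) \<in> R \<Longrightarrow> u \<in> words S \<Longrightarrow> v \<in> words S \<Longrightarrow> (u, v) \<in> word_cong S R"

definition presented_group :: "'g set \<Rightarrow> ('g word \<times> 'g word) set \<Rightarrow> 'g word set monoid" where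
  "presented_group S R =
    \<lparr> carrier = words S // word_cong S R,
      mult = (\<lambda>A B. \<Union>u\<in>A. \<Union>v\<in>B. word_cong S R `` {u @ v}),
      one = word_cong S R `` {[]} \<rparr>"

subsection \<open>Set-theoretical solutions, biracks and biquandles\<close>

abbreviation sig1 :: "('a \<times> 'a \<Rightarrow> 'a \<times> 'a) \<Rightarrow> 'a \<Rightarrow> 'a \<Rightarrow> 'a" where
  "sig1 \<sigma> x y \<equiv> fst (\<sigma> (x, y))"

abbreviation sig2 :: "('a \<times> 'a \<Rightarrow> 'a \<times> 'a) \<Rightarrow> 'a \<Rightarrow> 'a \<Rightarrow> 'a" where
  "sig2 \<sigma> x y \<equiv> snd (\<sigma> (x, y))"

definition id_times :: "('a \<times> 'a \<Rightarrow> 'a \<times> 'a) \<Rightarrow> 'a \<times> 'a \<times> 'a \<Rightarrow> 'a \<times> 'a \<times> 'a" where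
  "id_times \<sigma> = (\<lambda>(x, y, z). (x, sig1 \<sigma> y z, sig2 \<sigma> y z))"

definition times_id :: "('a \<times> 'a \<Rightarrow> 'a \<times> 'a) \<Rightarrow> 'a \<times> 'a \<times> 'a \<Rightarrow> 'a \<times> 'a \<times> 'a" where
  "times_id \<sigma> = (\<lambda>(x, y, z). (sig1 \<sigma> x y, sig2 \<sigma> x y, z))"

definition yang_baxter_solution :: "'a set \<Rightarrow> ('a \<times> 'a \<Rightarrow> 'a \<times> 'a) \<Rightarrow> bool" where
  "yang_baxter_solution X \<sigma> \<longleftrightarrow>
    bij_betw \<sigma> (X \<times> X) (X \<times> X) \<and>
    (\<forall>t \<in> X \<times> X \<times> X.
      id_times \<sigma> (times_id \<sigma> (id_times \<sigma> t)) = times_id \<sigma> (id_times \<sigma> (times_id \<sigma> t)))"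

definition birack :: "'a set \<Rightarrow> ('a \<times> 'a \<Rightarrow> 'a \<times> 'a) \<Rightarrow> bool" where
  "birack X \<sigma> \<longleftrightarrow>
    yang_baxter_solution X \<sigma> \<and>
    (\<forall>x\<in>X. \<forall>z\<in>X. \<exists>!y. y \<in> X \<and> sig1 \<sigma> x y = z) \<and>
    (\<forall>y\<in>X. \<forall>t\<in>X. \<exists>!x. x \<in> X \<and> sig2 \<sigma> x y = t)"

definition biquandle_bijection :: "'a set \<Rightarrow> ('a \<times> 'a \<Rightarrow> 'a \<times> 'a) \<Rightarrow> ('a \<Rightarrow> 'a) \<Rightarrow> bool" where
  "biquandle_bijection X \<sigma> s \<longleftrightarrow>
    bij_betw s X X \<and> {p \<in> X \<times> X. \<sigma> p = p} = {(x, s x) | x. x \<in> X}"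

definition biquandle :: "'a set \<Rightarrow> ('a \<times> 'a \<Rightarrow> 'a \<times> 'a) \<Rightarrow> bool" where
  "biquandle X \<sigma> \<longleftrightarrow> birack X \<sigma> \<and> (\<exists>s. biquandle_bijection X \<sigma> s)"

subsection \<open>Non-commutative 2-cocycles and the universal group\<close>

definition nc_cocycle ::
    "'a set \<Rightarrow> ('a \<times> 'a \<Rightarrow> 'a \<times> 'a) \<Rightarrow> ('h, 'm) monoid_scheme \<Rightarrow> ('a \<times> 'a \<Rightarrow> 'h) \<Rightarrow> bool" where
  "nc_cocycle X \<sigma> H f \<longleftrightarrow>
    group H \<and> f \<in> X \<times> X \<rightarrow> carrier H \<and>
    (\<forall>x\<in>X. \<forall>y\<in>X. \<forall>z\<in>X.
      f (x, y) \<otimes>\<^bsub>H\<^esub> f (sig2 \<sigma> x y, z) =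
        f (x, sig1 \<sigma> y z) \<otimes>\<^bsub>H\<^esub> f (sig2 \<sigma> x (sig1 \<sigma> y z), sig2 \<sigma> y z) \<and>
      f (sig1 \<sigma> x y, sig1 \<sigma> (sig2 \<sigma> x y) z) = f (y, z))"

definition type_I ::
    "'a set \<Rightarrow> ('a \<Rightarrow> 'a) \<Rightarrow> ('h, 'm) monoid_scheme \<Rightarrow> ('a \<times> 'a \<Rightarrow> 'h) \<Rightarrow> bool" where
  "type_I X s H f \<longleftrightarrow> (\<forall>x\<in>X. f (x, s x) = \<one>\<^bsub>H\<^esub>)"

definition unc_relations ::
    "'a set \<Rightarrow> ('a \<times> 'a \<Rightarrow> 'a \<times> 'a) \<Rightarrow> ('a \<Rightarrow> 'a) \<Rightarrow> (('a \<times> 'a) word \<times> ('a \<times> 'a) word) set" where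
  "unc_relations X \<sigma> s =
    {(gen (x, y) @ gen (sig2 \<sigma> x y, z),
      gen (x, sig1 \<sigma> y z) @ gen (sig2 \<sigma> x (sig1 \<sigma> y z), sig2 \<sigma> y z))
      | x y z. x \<in> X \<and> y \<in> X \<and> z \<in> X} \<union>
    {(gen (sig1 \<sigma> x y, sig1 \<sigma> (sig2 \<sigma> x y) z), gen (y, z))
      | x y z. x \<in> X \<and> y \<in> X \<and> z \<in> X} \<union>
    {(gen (x, s x), []) | x. x \<in> X}"

text \<open>The bijection s is determined on X by the solution, so passing it as a separate
  argument adds no data.\<close>

definition U_nc ::
    "'a set \<Rightarrow> ('a \<times> 'a \<Rightarrow> 'a \<times> 'a) \<Rightarrow> ('a \<Rightarrow> 'a) \<Rightarrow> ('a \<times> 'a) word set monoid" where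
  "U_nc X \<sigma> s = presented_group (X \<times> X) (unc_relations X \<sigma> s)"

definition unc_class ::
    "'a set \<Rightarrow> ('a \<times> 'a \<Rightarrow> 'a \<times> 'a) \<Rightarrow> ('a \<Rightarrow> 'a) \<Rightarrow> 'a \<times> 'a \<Rightarrow> ('a \<times> 'a) word set" where
  "unc_class X \<sigma> s p = word_cong (X \<times> X) (unc_relations X \<sigma> s) `` {gen p}"

end

theory Submission
  imports Defs
begin

text \<open>Words modulo the congruence generated by the relations and by free cancellation form a
  group in which every relation holds; evaluating a word letter by letter shows that this group
  is the universal one. A map \<open>f\<close> into a group \<open>H\<close> gives every word a value in \<open>H\<close>, and since
  evaluation respects concatenation and cancellation, it respects the whole congruence as soon
  as both sides of each relation have the same value. So \<open>f\<close> descends to a homomorphism on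
  congruence classes, and the descent is unique because the generators generate
  (\<open>presented_group_universal\<close>).

  The defining relations of the universal cocycle group are the cocycle equations and the
  type I equation, written with generators in place of values. Hence the relations make the
  class map a type I cocycle, and conversely a map from pairs to a group satisfies the
  relations exactly when it is a type I cocycle. Since the solution and the bijection \<open>s\<close> map
  into \<open>X\<close>, both sides of every such relation are words in the generators, so all of them are
  imposed on the group.\<close>

section \<open>The group of words modulo relations\<close>

lemma Nil_in_words [simp]: "[] \<in> words S"
  by (simp add: words_def)

lemma Cons_in_words [simp]: "(g, b) # w \<in> words S \<longleftrightarrow> g \<in> S \<and> w \<in> words S"
  by (simp add: words_def)

lemma append_in_words [simp]: "u @ v \<in> words S \<longleftrightarrow> u \<in> words S \<and> v \<in> words S"
  by (simp add: words_def)

lemma gen_in_words [simp]: "gen g \<in> words S \<longleftrightarrow> g \<in> S"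
  by (simp add: gen_def)

lemma word_cong_in_words:
  "(u, v) \<in> word_cong S R \<Longrightarrow> u \<in> words S \<and> v \<in> words S"
  by (induction rule: word_cong.induct) auto

lemma equiv_word_cong: "equiv (words S) (word_cong S R)"
proof (rule equivI)
  show "word_cong S R \<subseteq> words S \<times> words S"
    using word_cong_in_words by fast
  show "refl_on (words S) (word_cong S R)"
    by (rule refl_onI) (rule word_cong.refl)
  show "sym (word_cong S R)"
    by (rule symI) (rule word_cong.sym)
  show "trans (word_cong S R)"
    by (rule transI) (rule word_cong.trans)
qed

lemma word_class_eqI:
  "(u, v) \<in> word_cong S R \<Longrightarrow> word_cong S R `` {u} = word_cong S R `` {v}"
  by (rule equiv_class_eq[OF equiv_word_cong])

lemma word_class_in_carrier [simp]:
  "w \<in> words S \<Longrightarrow> word_cong S R `` {w} \<in> carrier (presented_group S R)"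
  by (simp add: presented_group_def quotientI)

lemma presented_group_carrierE:
  assumes "A \<in> carrier (presented_group S R)"
  obtains w where "w \<in> words S" "A = word_cong S R `` {w}"
  using assms by (auto simp: presented_group_def elim: quotientE)

lemma presented_group_one: "\<one>\<^bsub>presented_group S R\<^esub> = word_cong S R `` {[]}"
  by (simp add: presented_group_def)

text \<open>The product of two classes is a union over all representatives; since concatenation respects
  the congruence, every member of this union is the same class.\<close>

lemma presented_group_mult:
  assumes "u \<in> words S" "v \<in> words S"
  shows "word_cong S R `` {u} \<otimes>\<^bsub>presented_group S R\<^esub> word_cong S R `` {v} =
    word_cong S R `` {u @ v}"
proof -
  have const: "word_cong S R `` {u' @ v'} = word_cong S R `` {u @ v}"
    if "u' \<in> word_cong S R `` {u}" "v' \<in> word_cong S R `` {v}" for u' v'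
    using that by (intro word_class_eqI word_cong.sym[OF word_cong.append]) auto
  have "(\<Union>u'\<in>word_cong S R `` {u}. \<Union>v'\<in>word_cong S R `` {v}. word_cong S R `` {u' @ v'}) =
      (\<Union>u'\<in>word_cong S R `` {u}. \<Union>v'\<in>word_cong S R `` {v}. word_cong S R `` {u @ v})"
    by (intro SUP_cong HOL.refl const)
  also have "\<dots> = word_cong S R `` {u @ v}"
    using word_cong.refl[OF assms(1), of R] word_cong.refl[OF assms(2), of R] by blast
  finally show ?thesis
    by (simp only: presented_group_def monoid.simps)
qed

definition formal_inverse :: "'g word \<Rightarrow> 'g word" where
  "formal_inverse w = rev (map (\<lambda>(g, b). (g, \<not> b)) w)"

lemma formal_inverse_Cons: "formal_inverse ((g, b) # w) = formal_inverse w @ [(g, \<not> b)]"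
  by (simp add: formal_inverse_def)

lemma formal_inverse_in_words: "w \<in> words S \<Longrightarrow> formal_inverse w \<in> words S"
  by (induction w) (auto simp: formal_inverse_def)

text \<open>Letters cancel from the middle outwards: the last letter of the formal inverse meets
  the first letter of the word.\<close>

lemma formal_inverse_append_cong:
  "w \<in> words S \<Longrightarrow> (formal_inverse w @ w, []) \<in> word_cong S R"
proof (induction w)
  case Nil
  then show ?case by (simp add: formal_inverse_def word_cong.refl)
next
  case (Cons a w)
  obtain g b where a: "a = (g, b)" by fastforce
  with Cons.prems have g: "g \<in> S" and w: "w \<in> words S" by auto
  have "([(g, \<not> b), (g, b)] @ w, [] @ w) \<in> word_cong S R"
    using word_cong.cancel[OF g, of "\<not> b" R] w
    by (intro word_cong.append word_cong.refl) auto
  then have "(formal_inverse w @ [(g, \<not> b), (g, b)] @ w, formal_inverse w @ [] @ w)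
      \<in> word_cong S R"
    by (rule word_cong.append[OF word_cong.refl[OF formal_inverse_in_words[OF w]]])
  then have "(formal_inverse (a # w) @ a # w, formal_inverse w @ w) \<in> word_cong S R"
    by (simp add: a formal_inverse_Cons)
  then show ?case
    using Cons.IH[OF w] by (rule word_cong.trans)
qed

lemma group_presented_group: "group (presented_group S R)"
proof (rule groupI)
  show "A \<otimes>\<^bsub>presented_group S R\<^esub> B \<in> carrier (presented_group S R)"
    if "A \<in> carrier (presented_group S R)" "B \<in> carrier (presented_group S R)" for A B
    using that by (auto simp: presented_group_mult elim!: presented_group_carrierE)
  show "\<one>\<^bsub>presented_group S R\<^esub> \<in> carrier (presented_group S R)"
    by (simp add: presented_group_one)
  show "A \<otimes>\<^bsub>presented_group S R\<^esub> B \<otimes>\<^bsub>presented_group S R\<^esub> C =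
      A \<otimes>\<^bsub>presented_group S R\<^esub> (B \<otimes>\<^bsub>presented_group S R\<^esub> C)"
    if "A \<in> carrier (presented_group S R)" "B \<in> carrier (presented_group S R)"
      "C \<in> carrier (presented_group S R)" for A B C
    using that by (auto simp: presented_group_mult elim!: presented_group_carrierE)
  show "\<one>\<^bsub>presented_group S R\<^esub> \<otimes>\<^bsub>presented_group S R\<^esub> A = A"
    if "A \<in> carrier (presented_group S R)" for A
    using that
    by (auto simp: presented_group_mult presented_group_one elim!: presented_group_carrierE)
  show "\<exists>B \<in> carrier (presented_group S R).
      B \<otimes>\<^bsub>presented_group S R\<^esub> A = \<one>\<^bsub>presented_group S R\<^esub>"
    if "A \<in> carrier (presented_group S R)" for A
  proof -
    obtain w where w: "w \<in> words S" "A = word_cong S R `` {w}"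
      using \<open>A \<in> _\<close> by (rule presented_group_carrierE)
    then have "word_cong S R `` {formal_inverse w} \<otimes>\<^bsub>presented_group S R\<^esub> A =
        \<one>\<^bsub>presented_group S R\<^esub>"
      by (simp add: presented_group_mult presented_group_one formal_inverse_in_words
          word_class_eqI[OF formal_inverse_append_cong])
    then show ?thesis
      using word_class_in_carrier[OF formal_inverse_in_words[OF w(1)]] by (rule bexI)
  qed
qed

section \<open>Evaluation of words and the universal property\<close>

fun word_value :: "('h, 'm) monoid_scheme \<Rightarrow> ('g \<Rightarrow> 'h) \<Rightarrow> 'g word \<Rightarrow> 'h" where
  "word_value H f [] = \<one>\<^bsub>H\<^esub>"
| "word_value H f ((g, b) # w) = (if b then f g else inv\<^bsub>H\<^esub> f g) \<otimes>\<^bsub>H\<^esub> word_value H f w"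

context group
begin

lemma word_value_closed:
  assumes "f \<in> S \<rightarrow> carrier G"
  shows "w \<in> words S \<Longrightarrow> word_value G f w \<in> carrier G"
  using assms by (induction w) (auto simp: Pi_iff)

lemma word_value_append:
  assumes "f \<in> S \<rightarrow> carrier G" "v \<in> words S"
  shows "u \<in> words S \<Longrightarrow> word_value G f (u @ v) = word_value G f u \<otimes> word_value G f v"
proof (induction u)
  case Nil
  then show ?case using assms by (simp add: word_value_closed)
next
  case (Cons a u)
  then show ?case
    using assms word_value_closed[OF assms(1)] by (cases a) (auto simp: Pi_iff m_assoc)
qed

lemma word_value_gen [simp]: "f g \<in> carrier G \<Longrightarrow> word_value G f (gen g) = f g"
  by (simp add: gen_def)

text \<open>Having equal values is itself a congruence that contains the cancellations, so it contains
  the smallest congruence that contains the relations once it contains the relations.\<close>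

lemma word_value_cong:
  assumes f: "f \<in> S \<rightarrow> carrier G"
    and R: "\<And>u v. (u, v) \<in> R \<Longrightarrow> u \<in> words S \<Longrightarrow> v \<in> words S \<Longrightarrow>
      word_value G f u = word_value G f v"
  shows "(u, v) \<in> word_cong S R \<Longrightarrow> word_value G f u = word_value G f v"
proof (induction rule: word_cong.induct)
  case (append u u' v v')
  then show ?case
    using word_cong_in_words[OF append.hyps(1)] word_cong_in_words[OF append.hyps(2)]
    by (simp add: word_value_append[OF f])
next
  case (cancel g b)
  then have "f g \<in> carrier G" using f by auto
  then show ?case by auto
qed (auto intro: R)

text \<open>The class of an inverse letter is the inverse of the class of the generator, so a
  homomorphism has no freedom beyond its values on generators.\<close>

lemma hom_presented_group_word_value:
  assumes h: "h \<in> hom (presented_group S R) G"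
    and gens: "\<And>g. g \<in> S \<Longrightarrow> h (word_cong S R `` {gen g}) = f g"
  shows "w \<in> words S \<Longrightarrow> h (word_cong S R `` {w}) = word_value G f w"
proof -
  interpret P: group "presented_group S R" by (rule group_presented_group)
  interpret h: group_hom "presented_group S R" G h
    using h by unfold_locales
  have letter: "h (word_cong S R `` {[(g, b)]}) = (if b then f g else inv f g)"
    if g: "g \<in> S" for g b
  proof (cases b)
    case True
    then show ?thesis using gens[OF g] by (simp add: gen_def)
  next
    case False
    have "word_cong S R `` {[(g, False)]} \<otimes>\<^bsub>presented_group S R\<^esub> word_cong S R `` {gen g} =
        \<one>\<^bsub>presented_group S R\<^esub>"
      using word_class_eqI[OF word_cong.cancel[OF g, of False R]] g
      by (simp add: presented_group_mult presented_group_one gen_def)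
    then have "word_cong S R `` {[(g, False)]} =
        inv\<^bsub>presented_group S R\<^esub> (word_cong S R `` {gen g})"
      using g by (intro P.inv_equality[symmetric]) auto
    then show ?thesis
      using False g gens[OF g] by simp
  qed
  show "w \<in> words S \<Longrightarrow> h (word_cong S R `` {w}) = word_value G f w"
  proof (induction w)
    case Nil
    then show ?case using h.hom_one by (simp add: presented_group_one)
  next
    case (Cons a w)
    obtain g b where a: "a = (g, b)" by fastforce
    with Cons.prems have g: "g \<in> S" and w: "w \<in> words S" by auto
    have "word_cong S R `` {a # w} =
        word_cong S R `` {[(g, b)]} \<otimes>\<^bsub>presented_group S R\<^esub> word_cong S R `` {w}"
      using g w by (simp add: a presented_group_mult)
    then show ?case
      using g w Cons.IH[OF w] letter[OF g] by (simp add: a)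
  qed
qed

theorem presented_group_universal:
  assumes f: "f \<in> S \<rightarrow> carrier G"
    and R: "\<And>u v. (u, v) \<in> R \<Longrightarrow> u \<in> words S \<Longrightarrow> v \<in> words S \<Longrightarrow>
      word_value G f u = word_value G f v"
  shows "\<exists>!h. h \<in> hom (presented_group S R) G \<and> h \<in> extensional (carrier (presented_group S R)) \<and>
    (\<forall>g\<in>S. f g = h (word_cong S R `` {gen g}))"
proof (rule ex_ex1I)
  \<comment> \<open>Evaluation is constant on a congruence class, so its image of a class is a singleton.\<close>
  define h where "h = (\<lambda>A \<in> carrier (presented_group S R). the_elem (word_value G f ` A))"
  have h_class: "h (word_cong S R `` {w}) = word_value G f w" if w: "w \<in> words S" for w
  proof -
    have "the_elem (word_value G f ` (word_cong S R `` {w})) = word_value G f w"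
    proof (rule the_elem_image_unique)
      show "word_cong S R `` {w} \<noteq> {}"
        using word_cong.refl[OF w, of R] by blast
      show "word_value G f v = word_value G f w" if "v \<in> word_cong S R `` {w}" for v
        using that by (intro word_value_cong[OF f R, symmetric]) simp_all
    qed
    then show ?thesis using w by (simp add: h_def)
  qed
  have "h \<in> hom (presented_group S R) G"
  proof (rule homI)
    fix A
    assume "A \<in> carrier (presented_group S R)"
    then show "h A \<in> carrier G"
      by (elim presented_group_carrierE) (simp add: h_class word_value_closed[OF f])
  next
    fix A B
    assume "A \<in> carrier (presented_group S R)" "B \<in> carrier (presented_group S R)"
    then obtain u v where A: "u \<in> words S" "A = word_cong S R `` {u}"
      and B: "v \<in> words S" "B = word_cong S R `` {v}"
      by (elim presented_group_carrierE)
    show "h (A \<otimes>\<^bsub>presented_group S R\<^esub> B) = h A \<otimes> h B"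
      using A B by (simp add: h_class presented_group_mult word_value_append[OF f])
  qed
  moreover have "f g = h (word_cong S R `` {gen g})" if "g \<in> S" for g
    using that f by (simp add: h_class Pi_iff)
  ultimately show "\<exists>h. h \<in> hom (presented_group S R) G \<and>
      h \<in> extensional (carrier (presented_group S R)) \<and>
      (\<forall>g\<in>S. f g = h (word_cong S R `` {gen g}))"
    by (intro exI[of _ h]) (auto simp: h_def)
next
  fix h k
  assume h: "h \<in> hom (presented_group S R) G \<and> h \<in> extensional (carrier (presented_group S R)) \<and>
      (\<forall>g\<in>S. f g = h (word_cong S R `` {gen g}))"
    and k: "k \<in> hom (presented_group S R) G \<and> k \<in> extensional (carrier (presented_group S R)) \<and>
      (\<forall>g\<in>S. f g = k (word_cong S R `` {gen g}))"
  show "h = k"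
  proof (rule extensionalityI)
    fix A
    assume "A \<in> carrier (presented_group S R)"
    then obtain w where "w \<in> words S" "A = word_cong S R `` {w}"
      by (rule presented_group_carrierE)
    then show "h A = k A"
      using h k hom_presented_group_word_value[of h S R f w]
        hom_presented_group_word_value[of k S R f w] by simp
  qed (use h k in auto)
qed

end

section \<open>The universal cocycle group of a biquandle\<close>

lemma yang_baxter_solution_closed:
  assumes "yang_baxter_solution X \<sigma>" "x \<in> X" "y \<in> X"
  shows "sig1 \<sigma> x y \<in> X" "sig2 \<sigma> x y \<in> X"
proof -
  have "\<sigma> (x, y) \<in> X \<times> X"
    using assms by (auto simp: yang_baxter_solution_def dest: bij_betwE)
  then show "sig1 \<sigma> x y \<in> X" "sig2 \<sigma> x y \<in> X"
    by (auto simp: mem_Times_iff)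
qed

theorem proposition15:
  fixes X :: "'a set" and \<sigma> :: "'a \<times> 'a \<Rightarrow> 'a \<times> 'a" and s :: "'a \<Rightarrow> 'a"
  assumes "biquandle X \<sigma>" and "biquandle_bijection X \<sigma> s"
  shows "(nc_cocycle X \<sigma> (U_nc X \<sigma> s) (unc_class X \<sigma> s) \<and>
          type_I X s (U_nc X \<sigma> s) (unc_class X \<sigma> s)) \<and>
    (\<forall>(H :: ('h, 'm) monoid_scheme) f.
      group H \<and> nc_cocycle X \<sigma> H f \<and> type_I X s H f \<longrightarrow>
      (\<exists>!fbar. fbar \<in> hom (U_nc X \<sigma> s) H \<and> fbar \<in> extensional (carrier (U_nc X \<sigma> s)) \<and>
        (\<forall>p \<in> X \<times> X. f p = fbar (unc_class X \<sigma> s p))))"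
proof -
  have closed: "sig1 \<sigma> x y \<in> X" "sig2 \<sigma> x y \<in> X" if "x \<in> X" "y \<in> X" for x y
    using assms(1) that yang_baxter_solution_closed[of X \<sigma> x y]
    by (auto simp: biquandle_def birack_def)
  have s_closed: "s x \<in> X" if "x \<in> X" for x
    using assms(2) that by (auto simp: biquandle_bijection_def dest: bij_betwE)
  let ?R = "unc_relations X \<sigma> s"
  have relation: "word_cong (X \<times> X) ?R `` {u} = word_cong (X \<times> X) ?R `` {v}"
    if "(u, v) \<in> ?R" "u \<in> words (X \<times> X)" "v \<in> words (X \<times> X)" for u v
    using that by (intro word_class_eqI word_cong.relation)
  have cocycle: "nc_cocycle X \<sigma> (U_nc X \<sigma> s) (unc_class X \<sigma> s)"
    unfolding nc_cocycle_def
  proof (intro conjI ballI)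
    show "group (U_nc X \<sigma> s)"
      unfolding U_nc_def by (rule group_presented_group)
    show "unc_class X \<sigma> s \<in> X \<times> X \<rightarrow> carrier (U_nc X \<sigma> s)"
      by (auto simp: U_nc_def unc_class_def)
  next
    fix x y z
    assume xyz: "x \<in> X" "y \<in> X" "z \<in> X"
    have "(gen (x, y) @ gen (sig2 \<sigma> x y, z),
        gen (x, sig1 \<sigma> y z) @ gen (sig2 \<sigma> x (sig1 \<sigma> y z), sig2 \<sigma> y z)) \<in> ?R"
      using xyz unfolding unc_relations_def by blast
    then show "unc_class X \<sigma> s (x, y) \<otimes>\<^bsub>U_nc X \<sigma> s\<^esub> unc_class X \<sigma> s (sig2 \<sigma> x y, z) =
        unc_class X \<sigma> s (x, sig1 \<sigma> y z) \<otimes>\<^bsub>U_nc X \<sigma> s\<^esub>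
        unc_class X \<sigma> s (sig2 \<sigma> x (sig1 \<sigma> y z), sig2 \<sigma> y z)"
      using xyz relation by (simp add: U_nc_def unc_class_def presented_group_mult closed)
    have "(gen (sig1 \<sigma> x y, sig1 \<sigma> (sig2 \<sigma> x y) z), gen (y, z)) \<in> ?R"
      using xyz unfolding unc_relations_def by blast
    then show "unc_class X \<sigma> s (sig1 \<sigma> x y, sig1 \<sigma> (sig2 \<sigma> x y) z) = unc_class X \<sigma> s (y, z)"
      using xyz relation by (simp add: unc_class_def closed)
  qed
  have type_I: "type_I X s (U_nc X \<sigma> s) (unc_class X \<sigma> s)"
    unfolding type_I_def
  proof
    fix x
    assume x: "x \<in> X"
    then have "(gen (x, s x), []) \<in> ?R"
      unfolding unc_relations_def by blast
    then show "unc_class X \<sigma> s (x, s x) = \<one>\<^bsub>U_nc X \<sigma> s\<^esub>"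
      using x relation by (simp add: U_nc_def unc_class_def presented_group_one s_closed)
  qed
  have universal: "\<exists>!fbar. fbar \<in> hom (U_nc X \<sigma> s) H \<and>
      fbar \<in> extensional (carrier (U_nc X \<sigma> s)) \<and>
      (\<forall>p \<in> X \<times> X. f p = fbar (unc_class X \<sigma> s p))"
    if H: "group H" and f: "nc_cocycle X \<sigma> H f" "type_I X s H f"
    for H :: "('h, 'm) monoid_scheme" and f
  proof -
    interpret H: group H by (rule H)
    have f_closed: "f \<in> X \<times> X \<rightarrow> carrier H"
      using f(1) by (simp add: nc_cocycle_def)
    then have f_pair: "f (x, y) \<in> carrier H" if "x \<in> X" "y \<in> X" for x y
      using that by auto
    have "word_value H f u = word_value H f v" if "(u, v) \<in> ?R" for u v
      using that unfolding unc_relations_def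
    proof (elim UnE CollectE exE conjE)
      fix x y z
      assume xyz: "x \<in> X" "y \<in> X" "z \<in> X"
        and uv: "(u, v) = (gen (x, y) @ gen (sig2 \<sigma> x y, z),
          gen (x, sig1 \<sigma> y z) @ gen (sig2 \<sigma> x (sig1 \<sigma> y z), sig2 \<sigma> y z))"
      then show ?thesis
        using f(1) by (simp add: nc_cocycle_def H.word_value_append[OF f_closed] f_pair closed)
    next
      fix x y z
      assume xyz: "x \<in> X" "y \<in> X" "z \<in> X"
        and uv: "(u, v) = (gen (sig1 \<sigma> x y, sig1 \<sigma> (sig2 \<sigma> x y) z), gen (y, z))"
      then show ?thesis
        using f(1) by (simp add: nc_cocycle_def f_pair closed)
    next
      fix x
      assume "x \<in> X" "(u, v) = (gen (x, s x), [])"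
      then show ?thesis
        using f(2) by (simp add: type_I_def f_pair s_closed)
    qed
    then show ?thesis
      unfolding U_nc_def unc_class_def by (intro H.presented_group_universal f_closed)
  qed
  from cocycle type_I universal show ?thesis by blast
qed

end
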